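(* Let $q>1$ be real and $p=-q$. There is a polynomial-time algorithm (the greedy algorithm) for the maximum $p$-mean set cover problem which, on every instance with an $n$-element ground set, outputs a cover whose value $M_p(\{a_v: v\in V\})$ is at least $\mathrm{OPT}/\left(n^{1-\frac1q}\zeta(q)^{\frac1q}\right)$, where $\mathrm{OPT}$ is the optimal value and $\zeta(q)=\sum_{j=1}^\infty j^{-q}$ is the Riemann zeta function.
   Context: An instance of the maximum $p$-mean set cover problem consists of an $n$-element ground set $V$ and a collection $\mathcal S=\{S_1,\dots,S_k\}$ of subsets of $V$ whose union is $V$. A cover is a map $\phi:V\to\mathcal S$ with $v\in\phi(v)$ for all $v\in V$. For a cover $\phi$ and $v\in V$, let $a_v:=|\phi^{-1}(\phi(v))|$. The generalized mean is $M_p(\{a_v: v\in V\})=\left(\frac1n\sum_{v\in V}a_v^p\right)^{1/p}$. The problem asks for a cover maximizing $M_p(\{a_v : v\in V\})$. The greedy algorithm repeatedly chooses a set $S_i\in\mathcal S$ containing the maximum number of not-yet-covered elements and assigns all those uncovered elements to $S_i$, until every element is assigned. *)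

theory Defs
  imports Complex_Main "HOL-Library.FuncSet" "HOL-Computational_Algebra.Polynomial"
begin

section \<open>The maximum p-mean set cover problem\<close>

definition set_cover_instance :: "'a set \<Rightarrow> 'a set set \<Rightarrow> bool" where
  "set_cover_instance V \<S> \<longleftrightarrow> finite V \<and> \<Union>\<S> = V"

definition is_cover :: "'a set \<Rightarrow> 'a set set \<Rightarrow> ('a \<Rightarrow> 'a set) \<Rightarrow> bool" where
  "is_cover V \<S> \<phi> \<longleftrightarrow> \<phi> \<in> V \<rightarrow> \<S> \<and> (\<forall>v\<in>V. v \<in> \<phi> v)"

definition class_size :: "'a set \<Rightarrow> ('a \<Rightarrow> 'a set) \<Rightarrow> 'a \<Rightarrow> nat" where
  "class_size V \<phi> v = card {u \<in> V. \<phi> u = \<phi> v}"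

definition gen_mean :: "real \<Rightarrow> 'a set \<Rightarrow> ('a \<Rightarrow> real) \<Rightarrow> real" where
  "gen_mean p V a = (1 / real (card V) * (\<Sum>v\<in>V. a v powr p)) powr (1 / p)"

definition cover_value :: "real \<Rightarrow> 'a set \<Rightarrow> ('a \<Rightarrow> 'a set) \<Rightarrow> real" where
  "cover_value p V \<phi> = gen_mean p V (\<lambda>v. real (class_size V \<phi> v))"

definition OPT :: "real \<Rightarrow> 'a set \<Rightarrow> 'a set set \<Rightarrow> real" where
  "OPT p V \<S> = Max {cover_value p V \<phi> | \<phi>. is_cover V \<S> \<phi>}"

text \<open>The maximum in \<open>OPT\<close> is over a finite nonempty set, since the value of a cover only
  depends on its restriction to \<open>V\<close>.\<close>

lemma finite_cover_values:
  assumes "set_cover_instance V \<S>"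
  shows "finite {cover_value p V \<phi> | \<phi>. is_cover V \<S> \<phi>}"
proof (rule finite_subset)
  have "finite V" "finite \<S>"
    using assms finite_UnionD by (auto simp: set_cover_instance_def)
  then show "finite (cover_value p V ` (V \<rightarrow>\<^sub>E \<S>))"
    by (intro finite_imageI finite_PiE) auto
  have "{u \<in> V. restrict \<phi> V u = restrict \<phi> V v} = {u \<in> V. \<phi> u = \<phi> v}" if "v \<in> V"
    for \<phi> :: "'a \<Rightarrow> 'a set" and v
    using that by auto
  then have eq: "cover_value p V \<phi> = cover_value p V (restrict \<phi> V)" for \<phi>
    unfolding cover_value_def gen_mean_def class_size_def by (simp cong: sum.cong)
  show "{cover_value p V \<phi> | \<phi>. is_cover V \<S> \<phi>} \<subseteq> cover_value p V ` (V \<rightarrow>\<^sub>E \<S>)"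
  proof clarify
    fix \<phi> assume "is_cover V \<S> \<phi>"
    then have "restrict \<phi> V \<in> V \<rightarrow>\<^sub>E \<S>"
      by (auto simp: is_cover_def)
    then show "cover_value p V \<phi> \<in> cover_value p V ` (V \<rightarrow>\<^sub>E \<S>)"
      by (subst eq) (rule imageI)
  qed
qed

lemma cover_values_nonempty:
  assumes "set_cover_instance V \<S>"
  shows "{cover_value p V \<phi> | \<phi>. is_cover V \<S> \<phi>} \<noteq> {}"
proof -
  have "\<forall>v\<in>V. \<exists>S. S \<in> \<S> \<and> v \<in> S"
    using assms by (auto simp: set_cover_instance_def)
  then obtain \<phi> where "\<forall>v\<in>V. \<phi> v \<in> \<S> \<and> v \<in> \<phi> v"
    by metis
  then show ?thesis
    by (auto simp: is_cover_def)
qed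

definition zeta_real :: "real \<Rightarrow> real" where
  "zeta_real q = (\<Sum>j. real (Suc j) powr (- q))"

section \<open>The greedy algorithm\<close>

text \<open>\<open>greedy_run \<S> U \<phi>\<close>: \<open>\<phi>\<close> is a possible assignment of the elements of \<open>U\<close> by the greedy
  algorithm when \<open>U\<close> is the set of elements not yet covered. Ties are broken arbitrarily, hence a
  relation.\<close>

inductive greedy_run :: "'a set set \<Rightarrow> 'a set \<Rightarrow> ('a \<Rightarrow> 'a set) \<Rightarrow> bool" for \<S> where
  stop: "greedy_run \<S> {} \<phi>"
| pick: "\<lbrakk>U \<noteq> {}; S \<in> \<S>; \<forall>T\<in>\<S>. card (T \<inter> U) \<le> card (S \<inter> U); \<forall>v\<in>S \<inter> U. \<phi> v = S;
          greedy_run \<S> (U - S) \<phi>\<rbrakk> \<Longrightarrow> greedy_run \<S> U \<phi>"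

definition greedy_output :: "'a set \<Rightarrow> 'a set set \<Rightarrow> ('a \<Rightarrow> 'a set) \<Rightarrow> bool" where
  "greedy_output V \<S> \<phi> \<longleftrightarrow> greedy_run \<S> V \<phi>"

section \<open>Model of computation\<close>

text \<open>A random access machine with structured control flow. The memory consists of finitely many
  (named) infinite arrays of natural numbers; a scalar is cell 0 of an array. The only arithmetic
  is addition and truncated subtraction: multiplication is deliberately absent, so that in \<open>t\<close>
  steps numbers only grow to \<open>O(t)\<close> additional bits and unit-cost polynomial time coincides with
  polynomial time on Turing machines. Every store and every test counts as one step; the
  expressions occurring in a program are fixed, so evaluating them costs a constant number of
  elementary operations.\<close>

type_synonym memory = "string \<Rightarrow> nat \<Rightarrow> nat"

datatype expr = Const nat | Read string expr | Plus expr expr | Minus expr expr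

fun eval_expr :: "expr \<Rightarrow> memory \<Rightarrow> nat" where
  "eval_expr (Const m) s = m"
| "eval_expr (Read x e) s = s x (eval_expr e s)"
| "eval_expr (Plus e1 e2) s = eval_expr e1 s + eval_expr e2 s"
| "eval_expr (Minus e1 e2) s = eval_expr e1 s - eval_expr e2 s"

datatype prog =
    Store string expr expr
  | Seq prog prog
  | Cond expr prog prog
  | While expr prog

definition update :: "memory \<Rightarrow> string \<Rightarrow> nat \<Rightarrow> nat \<Rightarrow> memory" where
  "update s x i m = s(x := (s x)(i := m))"

text \<open>\<open>exec c s t s'\<close>: program \<open>c\<close> started in \<open>s\<close> halts in \<open>s'\<close> after \<open>t\<close> steps. Tests succeed
  on nonzero values.\<close>

inductive exec :: "prog \<Rightarrow> memory \<Rightarrow> nat \<Rightarrow> memory \<Rightarrow> bool" where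
  Store: "exec (Store x i e) s 1 (update s x (eval_expr i s) (eval_expr e s))"
| Seq: "\<lbrakk>exec c1 s t1 s1; exec c2 s1 t2 s2\<rbrakk> \<Longrightarrow> exec (Seq c1 c2) s (t1 + t2) s2"
| CondTrue: "\<lbrakk>eval_expr b s \<noteq> 0; exec c1 s t s1\<rbrakk> \<Longrightarrow> exec (Cond b c1 c2) s (1 + t) s1"
| CondFalse: "\<lbrakk>eval_expr b s = 0; exec c2 s t s1\<rbrakk> \<Longrightarrow> exec (Cond b c1 c2) s (1 + t) s1"
| WhileFalse: "eval_expr b s = 0 \<Longrightarrow> exec (While b c) s 1 s"
| WhileTrue: "\<lbrakk>eval_expr b s \<noteq> 0; exec c s t1 s1; exec (While b c) s1 t2 s2\<rbrakk>
    \<Longrightarrow> exec (While b c) s (1 + t1 + t2) s2"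

inductive_cases exec_StoreE: "exec (Store x i e) s t s'"
inductive_cases exec_SeqE: "exec (Seq c1 c2) s t s'"
inductive_cases exec_CondE: "exec (Cond b c1 c2) s t s'"
inductive_cases exec_WhileE: "exec (While b c) s t s'"

lemma exec_deterministic:
  "exec c s t r \<Longrightarrow> exec c s t' r' \<Longrightarrow> t = t' \<and> r = r'"
proof (induction arbitrary: t' r' rule: exec.induct)
  case (Store x i e s)
  then show ?case by (auto elim: exec_StoreE)
next
  case (Seq c1 s t1 s1 c2 t2 s2)
  from Seq.prems obtain u1 r u2 where u: "t' = u1 + u2" "exec c1 s u1 r" "exec c2 r u2 r'"
    by (rule exec_SeqE)
  from Seq.IH(1)[OF u(2)] have "t1 = u1" "s1 = r" by simp_all
  with Seq.IH(2)[of u2 r'] u show ?case by simp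
next
  case (CondTrue b s c1 t s1 c2)
  from CondTrue.prems CondTrue.hyps(1) obtain u where u: "t' = Suc u" "exec c1 s u r'"
    by (auto elim: exec_CondE)
  with CondTrue.IH[OF u(2)] show ?case by simp
next
  case (CondFalse b s c2 t s1 c1)
  from CondFalse.prems CondFalse.hyps(1) obtain u where u: "t' = Suc u" "exec c2 s u r'"
    by (auto elim: exec_CondE)
  with CondFalse.IH[OF u(2)] show ?case by simp
next
  case (WhileFalse b s c)
  then show ?case by (auto elim: exec_WhileE)
next
  case (WhileTrue b s c t1 s1 t2 s2)
  from WhileTrue.prems WhileTrue.hyps(1)
  obtain u1 r u2 where u: "t' = Suc (u1 + u2)" "exec c s u1 r" "exec (While b c) r u2 r'"
    by (auto elim: exec_WhileE)
  from WhileTrue.IH(1)[OF u(2)] have "t1 = u1" "s1 = r" by simp_all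
  with WhileTrue.IH(2)[of u2 r'] u show ?case by simp
qed

section \<open>Polynomial-time algorithms on set systems\<close>

text \<open>An instance on the ground set \<open>{..<n}\<close>, with the collection given as a list \<open>Ss\<close>, is
  presented by \<open>n\<close>, the length of \<open>Ss\<close> and the row-major incidence matrix; all other cells are 0.
  Repetitions in \<open>Ss\<close> are allowed.\<close>

definition encode :: "nat \<Rightarrow> nat set list \<Rightarrow> memory" where
  "encode n Ss = (\<lambda>x i.
     if x = ''n'' \<and> i = 0 then n
     else if x = ''k'' \<and> i = 0 then length Ss
     else if x = ''A'' \<and> i < length Ss * n then of_bool (i mod n \<in> Ss ! (i div n))
     else 0)"

definition input_size :: "nat \<Rightarrow> nat set list \<Rightarrow> nat" where
  "input_size n Ss = n + length Ss + n * length Ss"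

text \<open>The answer is read off the array \<open>out\<close>, whose entry at \<open>v\<close> is the position in \<open>Ss\<close> of the
  set that \<open>v\<close> is assigned to.\<close>

definition decode :: "nat set list \<Rightarrow> memory \<Rightarrow> nat \<Rightarrow> nat set" where
  "decode Ss s v = Ss ! (s ''out'' v)"

definition poly_time_algorithm ::
    "prog \<Rightarrow> (nat set \<Rightarrow> nat set set \<Rightarrow> (nat \<Rightarrow> nat set) \<Rightarrow> bool) \<Rightarrow> bool" where
  "poly_time_algorithm c R \<longleftrightarrow>
     (\<exists>P :: nat poly. \<forall>n Ss. set_cover_instance {..<n} (set Ss) \<longrightarrow>
        (\<exists>t s. exec c (encode n Ss) t s \<and> t \<le> poly P (input_size n Ss) \<and>
               (\<forall>v<n. s ''out'' v < length Ss) \<and>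
               R {..<n} (set Ss) (decode Ss s)))"

end

theory Submission
  imports Defs "HOL-Analysis.Summation_Tests"
begin

text \<open>Approximation ratio: consider a class of size \<open>m\<close> of an optimal cover. When its \<open>j\<close>-th element
  from the end is covered by the greedy algorithm, the set of the optimal cover still has at least
  \<open>j\<close> uncovered elements, so the greedy class of this element has size at least \<open>j\<close>. Hence the class
  contributes at most \<open>\<zeta>(q)\<close> to the greedy sum of the \<open>a\<^sub>v\<close>-powers, whereas it contributes
  \<open>m\<^sup>1\<^sup>-\<^sup>q \<ge> n\<^sup>1\<^sup>-\<^sup>q\<close> to the optimal one.

  Running time: \<open>n\<close> greedy rounds always suffice, as rounds after the ground set has been exhausted
  change nothing. Keeping a running offset into the incidence matrix avoids multiplications.\<close>

section \<open>Approximation ratio\<close>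

lemma greedy_run_is_cover: "greedy_run \<S> U \<phi> \<Longrightarrow> is_cover U \<S> \<phi>"
  by (induction rule: greedy_run.induct) (auto simp: is_cover_def Pi_iff)

text \<open>Induction along the run, with \<open>V\<close> fixed because class sizes refer to the
  whole ground set. The elements of \<open>C\<close> taken by the current choice \<open>S\<close>
  account for the last \<open>card (C \<inter> S)\<close> terms on the right, the others for the
  first \<open>card (C - S)\<close>.\<close>

lemma greedy_run_class_sum_le:
  assumes "greedy_run \<S> U \<phi>" "finite V" "U \<subseteq> V" "T \<in> \<S>" "C \<subseteq> T \<inter> U" "q > 0"
  shows "(\<Sum>v\<in>C. real (class_size V \<phi> v) powr - q) \<le> (\<Sum>j<card C. real (Suc j) powr - q)"
  using assms
proof (induction arbitrary: C rule: greedy_run.induct)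
  case (stop \<phi>)
  then show ?case by simp
next
  case (pick U S \<phi>)
  let ?f = "\<lambda>v. real (class_size V \<phi> v) powr - q" and ?g = "\<lambda>j. real (Suc j) powr - q"
  have "finite U"
    using pick.prems(1,2) by (rule rev_finite_subset)
  then have fin: "finite U" "finite C"
    using pick.prems(4) by (auto dest: finite_subset)
  have "card C \<le> card (T \<inter> U)"
    using pick.prems(4) fin(1) by (intro card_mono) auto
  also have "\<dots> \<le> card (S \<inter> U)"
    using pick.hyps(3) pick.prems(3) by blast
  finally have C_le: "card C \<le> card (S \<inter> U)" .
  have f_le: "?f v \<le> real (card C) powr - q" if "v \<in> C \<inter> S" for v
  proof -
    have "S \<inter> U \<subseteq> {u \<in> V. \<phi> u = \<phi> v}"
      using that pick.hyps(4) pick.prems(2,4) by auto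
    then have "card (S \<inter> U) \<le> class_size V \<phi> v"
      unfolding class_size_def using pick.prems by (intro card_mono) auto
    moreover have "card C > 0"
      using that fin card_gt_0_iff by blast
    ultimately show ?thesis
      using C_le \<open>q > 0\<close> by (intro powr_mono2') auto
  qed
  have card_split: "card C = card (C - S) + card (C \<inter> S)"
    using fin card_Int_Diff[of C S] by simp
  have "(\<Sum>v\<in>C. ?f v) = (\<Sum>v\<in>C - S. ?f v) + (\<Sum>v\<in>C \<inter> S. ?f v)"
    using sum.Int_Diff[of C ?f S] fin by simp
  also have "(\<Sum>v\<in>C - S. ?f v) \<le> (\<Sum>j<card (C - S). ?g j)"
    using pick.prems by (intro pick.IH) auto
  also have "(\<Sum>v\<in>C \<inter> S. ?f v) \<le> (\<Sum>j\<in>{card (C - S)..<card C}. real (card C) powr - q)"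
    using sum_mono[of "C \<inter> S" ?f "\<lambda>_. real (card C) powr - q"] f_le card_split by simp
  \<comment> \<open>Indices in this range satisfy \<open>Suc j \<le> card C\<close>, and the power
    is antitone.\<close>
  also have "\<dots> \<le> (\<Sum>j\<in>{card (C - S)..<card C}. ?g j)"
    using \<open>q > 0\<close> by (intro sum_mono powr_mono2') auto
  also have "(\<Sum>j<card (C - S). ?g j) + \<dots> = (\<Sum>j<card C. ?g j)"
    using card_split sum.atLeastLessThan_concat[of 0 "card (C - S)" "card C" ?g]
    by (simp add: lessThan_atLeast0)
  finally show ?case by simp
qed

lemma summable_zeta_real:
  assumes "q > 1"
  shows "summable (\<lambda>j. real (Suc j) powr - q)"
proof -
  have "summable (\<lambda>j. real j powr - q)"
    using assms by (subst summable_real_powr_iff) simp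
  then show ?thesis
    by (subst summable_Suc_iff)
qed

lemma class_size_pos: "finite V \<Longrightarrow> v \<in> V \<Longrightarrow> class_size V \<phi> v > 0"
  unfolding class_size_def by (subst card_gt_0_iff) auto

text \<open>The estimate is made for each class of an arbitrary cover \<open>\<psi>\<close> and then
  summed over the sets that \<open>\<psi>\<close> uses.\<close>

lemma greedy_power_sum_le:
  fixes q :: real
  assumes "q > 1" "finite V" "is_cover V \<S> \<psi>" "greedy_run \<S> V \<phi>"
  shows "(\<Sum>v\<in>V. real (class_size V \<phi> v) powr - q)
    \<le> real (card V) powr (q - 1) * zeta_real q * (\<Sum>v\<in>V. real (class_size V \<psi> v) powr - q)"
proof -
  let ?f = "\<lambda>v. real (class_size V \<phi> v) powr - q"
  let ?g = "\<lambda>v. real (class_size V \<psi> v) powr - q"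
  let ?C = "\<lambda>T. {u \<in> V. \<psi> u = T}"
  let ?n = "real (card V)"
  have class_le: "sum ?f (?C T) \<le> ?n powr (q - 1) * zeta_real q * sum ?g (?C T)" if T: "T \<in> \<psi> ` V" for T
  proof -
    have m: "card (?C T) > 0" "card (?C T) \<le> card V"
      using T \<open>finite V\<close> by (auto simp: card_gt_0_iff intro: card_mono)
    have "T \<in> \<S>" "?C T \<subseteq> T \<inter> V"
      using T assms(3) by (auto simp: is_cover_def)
    then have "sum ?f (?C T) \<le> (\<Sum>j<card (?C T). real (Suc j) powr - q)"
      using assms by (intro greedy_run_class_sum_le[of \<S> V _ _ T]) auto
    also have "\<dots> \<le> zeta_real q"
      unfolding zeta_real_def using summable_zeta_real[OF \<open>q > 1\<close>] by (intro sum_le_suminf) auto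
    finally have le: "sum ?f (?C T) \<le> zeta_real q" .
    then have "zeta_real q \<ge> 0"
      by (smt (verit) powr_ge_zero sum_nonneg)
    have "sum ?g (?C T) = (\<Sum>v\<in>?C T. real (card (?C T)) powr - q)"
      by (intro sum.cong) (auto simp: class_size_def)
    also have "\<dots> = real (card (?C T)) powr (1 - q)"
      using m by (simp add: powr_diff powr_minus_divide)
    also have "\<dots> \<ge> ?n powr (1 - q)"
      using m \<open>q > 1\<close> by (intro powr_mono2') auto
    finally have "?n powr (q - 1) * sum ?g (?C T) \<ge> ?n powr (q - 1) * ?n powr (1 - q)"
      by (intro mult_left_mono) auto
    also have "?n powr (q - 1) * ?n powr (1 - q) = 1"
      using m by (simp flip: powr_add)
    finally show ?thesis
      using le \<open>zeta_real q \<ge> 0\<close> mult_left_mono[of 1 "?n powr (q - 1) * sum ?g (?C T)" "zeta_real q"]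
      by (simp add: mult_ac)
  qed
  have "sum ?f V = (\<Sum>T\<in>\<psi> ` V. sum ?f (?C T))"
    using \<open>finite V\<close> by (rule sum.image_gen)
  also have "\<dots> \<le> (\<Sum>T\<in>\<psi> ` V. ?n powr (q - 1) * zeta_real q * sum ?g (?C T))"
    by (intro sum_mono class_le)
  also have "\<dots> = ?n powr (q - 1) * zeta_real q * sum ?g V"
    using \<open>finite V\<close> by (subst sum.image_gen[of V ?g \<psi>]) (simp_all add: sum_distrib_left)
  finally show ?thesis .
qed

text \<open>Raising to the power \<open>- 1 / q\<close> is antitone, so the upper bound on the power
  sum becomes a lower bound on the mean, and the exponent \<open>q - 1\<close> of the size becomes
  \<open>1 - 1 / q\<close> in the denominator.\<close>

lemma greedy_cover_value_ge:
  fixes q :: real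
  assumes "q > 1" "set_cover_instance V \<S>" "greedy_run \<S> V \<phi>"
  shows "cover_value (- q) V \<phi> \<ge>
    OPT (- q) V \<S> / (real (card V) powr (1 - 1 / q) * zeta_real q powr (1 / q))"
proof -
  have "finite V"
    using assms by (simp add: set_cover_instance_def)
  obtain \<psi> where \<psi>: "is_cover V \<S> \<psi>" "OPT (- q) V \<S> = cover_value (- q) V \<psi>"
    using Max_in[OF finite_cover_values cover_values_nonempty, OF assms(2,2), of "- q"]
    unfolding OPT_def by blast
  show ?thesis
  proof (cases "V = {}")
    \<comment> \<open>Both values are powers of 0 here, hence 0.\<close>
    case True
    then show ?thesis
      by (simp add: \<psi> cover_value_def gen_mean_def)
  next
    case False
    define N where "N = real (card V)"
    define G where "G = (\<Sum>v\<in>V. real (class_size V \<phi> v) powr - q)"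
    define H where "H = (\<Sum>v\<in>V. real (class_size V \<psi> v) powr - q)"
    have pos: "N > 0" "G > 0" "H > 0"
      using False \<open>finite V\<close> class_size_pos[OF \<open>finite V\<close>]
      by (auto simp: N_def G_def H_def card_gt_0_iff intro!: sum_pos)
    have GH: "G \<le> N powr (q - 1) * zeta_real q * H"
      unfolding G_def H_def N_def using assms \<open>finite V\<close> \<psi>(1) by (intro greedy_power_sum_le)
    have z: "zeta_real q > 0"
      using GH pos by (smt (verit) mult_nonneg_nonpos mult_nonpos_nonneg powr_ge_zero)
    have "(G / N) powr (- 1 / q) \<ge> (N powr (q - 1) * zeta_real q * (H / N)) powr (- 1 / q)"
      using GH pos assms(1) by (intro powr_mono2') (auto simp: divide_right_mono)
    also have "(a * b * c) powr (- 1 / q) = c powr (- 1 / q) / (a powr (1 / q) * b powr (1 / q))"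
      for a b c :: real
      by (simp add: powr_mult powr_minus_divide)
    also have "(N powr (q - 1)) powr (1 / q) = N powr ((q - 1) / q)"
      by (simp add: powr_powr)
    also have "(q - 1) / q = 1 - 1 / q"
      using assms(1) by (simp add: field_simps)
    finally show ?thesis
      by (simp add: \<psi> cover_value_def gen_mean_def G_def H_def N_def)
  qed
qed

section \<open>Time-bounded total correctness\<close>

text \<open>\<open>T\<close> is only an upper bound, so that branches of different length can share
  one budget.\<close>

definition runs :: "prog \<Rightarrow> memory \<Rightarrow> nat \<Rightarrow> (memory \<Rightarrow> bool) \<Rightarrow> bool" where
  "runs c s T Q \<longleftrightarrow> (\<exists>t s'. exec c s t s' \<and> t \<le> T \<and> Q s')"

lemma runs_Store:
  "1 \<le> T \<Longrightarrow> Q (update s x (eval_expr i s) (eval_expr e s)) \<Longrightarrow> runs (Store x i e) s T Q"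
  unfolding runs_def using exec.Store by blast

lemma runs_Seq: "runs c1 s T1 (\<lambda>s'. runs c2 s' T2 Q) \<Longrightarrow> runs (Seq c1 c2) s (T1 + T2) Q"
  unfolding runs_def by (blast intro: exec.Seq add_le_mono)

lemma runs_Seq_Store:
  assumes "1 \<le> T" "runs c (update s x (eval_expr i s) (eval_expr e s)) (T - 1) Q"
  shows "runs (Seq (Store x i e) c) s T Q"
  using runs_Seq[of "Store x i e" s 1 c "T - 1" Q] runs_Store[of 1] assms by simp

lemma runs_Cond:
  assumes "1 \<le> T" "runs (if eval_expr b s \<noteq> 0 then c1 else c2) s (T - 1) Q"
  shows "runs (Cond b c1 c2) s T Q"
proof -
  obtain t s' where t: "exec (if eval_expr b s \<noteq> 0 then c1 else c2) s t s'" "t \<le> T - 1" "Q s'"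
    using assms(2) by (auto simp: runs_def)
  then have "exec (Cond b c1 c2) s (1 + t) s'"
    by (cases "eval_expr b s = 0") (use exec.CondTrue exec.CondFalse in auto)
  then show ?thesis
    unfolding runs_def using t \<open>1 \<le> T\<close> by (intro exI[of _ "1 + t"] exI[of _ s']) auto
qed

lemma runs_mono: "runs c s T Q \<Longrightarrow> T \<le> T' \<Longrightarrow> (\<And>s'. Q s' \<Longrightarrow> Q' s') \<Longrightarrow> runs c s T' Q'"
  unfolding runs_def by (blast intro: le_trans)

text \<open>A rule for counted loops: \<open>I\<close> is indexed by the iterations done and the
  guard evaluates to the number of those left, so there are exactly \<open>N\<close>. Each costs its
  body and one test; the final \<open>+ 1\<close> is the failing test.\<close>

lemma runs_While:
  assumes "I 0 s"
    and "\<And>i s. I i s \<Longrightarrow> eval_expr b s = N - i"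
    and "\<And>i s. I i s \<Longrightarrow> i < N \<Longrightarrow> runs c s T (I (Suc i))"
  shows "runs (While b c) s (N * (T + 1) + 1) (I N)"
proof -
  have "runs (While b c) s ((N - i) * (T + 1) + 1) (I N)" if "i \<le> N" "I i s" for i s
    using that
  proof (induction arbitrary: s rule: inc_induct)
    case base
    then show ?case
      using assms(2)[of N s] exec.WhileFalse[of b s c] by (auto simp: runs_def)
  next
    case (step i)
    from assms(3)[OF step.prems step.hyps(2)] obtain t1 s1
      where 1: "exec c s t1 s1" "t1 \<le> T" "I (Suc i) s1"
      by (auto simp: runs_def)
    from step.IH[OF 1(3)] obtain t2 s2
      where 2: "exec (While b c) s1 t2 s2" "t2 \<le> (N - Suc i) * (T + 1) + 1" "I N s2"
      by (auto simp: runs_def)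
    have "exec (While b c) s (1 + t1 + t2) s2"
      using assms(2)[OF step.prems] step.hyps 1 2 by (intro exec.WhileTrue) auto
    moreover have "N - i = Suc (N - Suc i)"
      using step.hyps by simp
    then have "1 + t1 + t2 \<le> (N - i) * (T + 1) + 1"
      using 1 2 by simp
    ultimately show ?case
      using 2 by (auto simp: runs_def)
  qed
  from this[of 0 s] show ?thesis
    using assms(1) by simp
qed

section \<open>The greedy algorithm as a program\<close>

abbreviation Var :: "string \<Rightarrow> expr" where
  "Var x \<equiv> Read x (Const 0)"

abbreviation Assign :: "string \<Rightarrow> expr \<Rightarrow> prog" where
  "Assign x e \<equiv> Store x (Const 0) e"

abbreviation Incr :: "string \<Rightarrow> prog" where
  "Incr x \<equiv> Assign x (Plus (Var x) (Const 1))"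

text \<open>Scalars: round \<open>r\<close>, candidate set \<open>i\<close>, element \<open>v\<close>, position \<open>o\<close> in the incidence matrix,
  count \<open>c\<close> of the uncovered elements of the candidate; best candidate \<open>d\<close>, its matrix row offset
  \<open>e\<close> and its count \<open>b\<close>. The array \<open>C\<close> flags the covered elements. As all entries are 0 or 1,
  truncated subtraction computes conjunction with a negated flag.\<close>

definition count_body :: prog where
  "count_body =
    Seq (Assign ''c'' (Plus (Var ''c'') (Minus (Read ''A'' (Var ''o'')) (Read ''C'' (Var ''v'')))))
    (Seq (Incr ''v'') (Incr ''o''))"

text \<open>After the inner loop \<open>o\<close> points just past row \<open>i\<close>, so
  subtracting \<open>n\<close> recovers the start of the row. As \<open>prog\<close> has no empty
  command, both branches end with the increment.\<close>

definition select_body :: prog where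
  "select_body =
    Seq (Assign ''c'' (Const 0))
    (Seq (Assign ''v'' (Const 0))
    (Seq (While (Minus (Var ''n'') (Var ''v'')) count_body)
    (Cond (Minus (Var ''c'') (Var ''b''))
      (Seq (Assign ''b'' (Var ''c''))
      (Seq (Assign ''d'' (Var ''i''))
      (Seq (Assign ''e'' (Minus (Var ''o'') (Var ''n'')))
      (Incr ''i''))))
      (Incr ''i''))))"

definition assign_body :: prog where
  "assign_body =
    Cond (Minus (Read ''A'' (Plus (Var ''e'') (Var ''v''))) (Read ''C'' (Var ''v'')))
      (Seq (Store ''out'' (Var ''v'') (Var ''d''))
      (Seq (Store ''C'' (Var ''v'') (Const 1))
      (Incr ''v'')))
      (Incr ''v'')"

text \<open>Once everything is covered, no count is positive: \<open>d\<close> keeps its default 0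
  and the second loop assigns nothing.\<close>

definition round_body :: prog where
  "round_body =
    Seq (Assign ''b'' (Const 0))
    (Seq (Assign ''d'' (Const 0))
    (Seq (Assign ''e'' (Const 0))
    (Seq (Assign ''i'' (Const 0))
    (Seq (Assign ''o'' (Const 0))
    (Seq (While (Minus (Var ''k'') (Var ''i'')) select_body)
    (Seq (Assign ''v'' (Const 0))
    (Seq (While (Minus (Var ''n'') (Var ''v'')) assign_body)
    (Incr ''r''))))))))"

definition greedy_prog :: prog where
  "greedy_prog = While (Minus (Var ''n'') (Var ''r'')) round_body"

lemma encode_matrix:
  "i < length Ss \<Longrightarrow> v < n \<Longrightarrow> encode n Ss ''A'' (i * n + v) = of_bool (v \<in> Ss ! i)"
proof -
  assume "i < length Ss" "v < n"
  then have "Suc i * n \<le> length Ss * n"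
    by (intro mult_le_mono1) simp
  with \<open>v < n\<close> have "i * n + v < length Ss * n"
    by simp
  with \<open>v < n\<close> show ?thesis
    by (simp add: encode_def)
qed

section \<open>Loop invariants\<close>

context
  fixes n :: nat and Ss :: "nat set list"
begin

definition frame :: "nat set \<Rightarrow> (nat \<Rightarrow> nat) \<Rightarrow> nat \<Rightarrow> memory \<Rightarrow> bool" where
  "frame D f r s \<longleftrightarrow> s ''n'' 0 = n \<and> s ''k'' 0 = length Ss \<and> s ''A'' = encode n Ss ''A'' \<and>
    s ''C'' = (\<lambda>v. of_bool (v \<in> D)) \<and> s ''out'' = f \<and> s ''r'' 0 = r"

text \<open>The parameters \<open>b\<close>, \<open>d\<close>, \<open>e\<close> express that
  counting leaves the best candidate so far untouched.\<close>

definition count_inv where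
  "count_inv D f r i b d e v s \<longleftrightarrow> frame D f r s \<and> s ''i'' 0 = i \<and> s ''b'' 0 = b \<and> s ''d'' 0 = d \<and>
    s ''e'' 0 = e \<and> s ''v'' 0 = v \<and> s ''o'' 0 = i * n + v \<and> s ''c'' 0 = card ((Ss ! i - D) \<inter> {..<v})"

text \<open>An inequality for \<open>b\<close>, since the default \<open>d\<close> = 0,
  \<open>b\<close> = 0 may undercount. For \<open>i = length Ss\<close>, the last two conjuncts
  still make \<open>d\<close> a maximiser.\<close>

definition select_inv where
  "select_inv D f r i s \<longleftrightarrow> frame D f r s \<and> s ''i'' 0 = i \<and> s ''o'' 0 = i * n \<and>
    s ''d'' 0 < length Ss \<and> s ''e'' 0 = s ''d'' 0 * n \<and> s ''b'' 0 \<le> card (Ss ! (s ''d'' 0) - D) \<and>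
    (\<forall>j<i. card (Ss ! j - D) \<le> s ''b'' 0)"

text \<open>\<open>D\<close> and \<open>f\<close> describe the state at the start of the round,
  while the flags and the output change as \<open>v\<close> advances.\<close>

definition assign_inv where
  "assign_inv D f r d v s \<longleftrightarrow>
    frame (D \<union> Ss ! d \<inter> {..<v}) (\<lambda>u. if u < v \<and> u \<in> Ss ! d - D then d else f u) r s \<and>
    s ''d'' 0 = d \<and> s ''e'' 0 = d * n \<and> s ''v'' 0 = v"

text \<open>The last conjunct says that the partial assignment \<open>f\<close> on the covered set \<open>D\<close> was made by
  greedy choices; phrased backwards, it fits the recursion of \<open>greedy_run\<close>.\<close>

definition round_inv where
  "round_inv r s \<longleftrightarrow> (\<exists>D f. frame D f r s \<and> D \<subseteq> {..<n} \<and> card ({..<n} - D) \<le> n - r \<and>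
    (\<forall>v\<in>D. f v < length Ss) \<and>
    (\<forall>\<psi>. greedy_run (set Ss) ({..<n} - D) \<psi> \<longrightarrow> (\<forall>v\<in>D. \<psi> v = Ss ! f v) \<longrightarrow>
      greedy_run (set Ss) {..<n} \<psi>))"

section \<open>Bodies of the inner loops\<close>

lemma runs_count_body:
  assumes "count_inv D f r i b d e v s" "i < length Ss" "v < n"
  shows "runs count_body s 3 (count_inv D f r i b d e (Suc v))"
proof -
  \<comment> \<open>The truncated difference is 1 exactly for \<open>v \<in> Ss ! i - D\<close>; the
    program computes the same term.\<close>
  have "card ((Ss ! i - D) \<inter> {..<Suc v}) =
      card ((Ss ! i - D) \<inter> {..<v}) + (of_bool (v \<in> Ss ! i) - of_bool (v \<in> D))"
    by (simp add: lessThan_Suc Int_insert_right)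
  then show ?thesis
    using assms unfolding count_body_def
    by (intro runs_Seq_Store runs_Store)
      (simp_all add: update_def count_inv_def frame_def encode_matrix)
qed

lemma runs_assign_body:
  assumes inv: "assign_inv D f r d v s" and "d < length Ss" "v < n"
  shows "runs assign_body s 4 (assign_inv D f r d (Suc v))"
proof -
  let ?g = "\<lambda>v u. if u < v \<and> u \<in> Ss ! d - D then d else f u"
  have test: "eval_expr (Minus (Read ''A'' (Plus (Var ''e'') (Var ''v''))) (Read ''C'' (Var ''v''))) s
      = of_bool (v \<in> Ss ! d - D)"
    using assms by (simp add: assign_inv_def frame_def encode_matrix)
  show ?thesis
  proof (cases "v \<in> Ss ! d - D")
    case True
    have "(\<lambda>u. of_bool (u \<in> D \<union> Ss ! d \<inter> {..<v}))(v := 1) =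
        (\<lambda>u. of_bool (u \<in> D \<union> Ss ! d \<inter> {..<Suc v}) :: nat)" "(?g v)(v := d) = ?g (Suc v)"
      using True by (auto simp: fun_eq_iff less_Suc_eq)
    then have "runs (Seq (Store ''out'' (Var ''v'') (Var ''d''))
        (Seq (Store ''C'' (Var ''v'') (Const 1)) (Incr ''v''))) s 3 (assign_inv D f r d (Suc v))"
      using inv by (intro runs_Seq_Store runs_Store) (simp_all add: assign_inv_def frame_def update_def)
    then show ?thesis
      unfolding assign_body_def using test True by (intro runs_Cond) simp_all
  next
    case False
    then have "D \<union> Ss ! d \<inter> {..<v} = D \<union> Ss ! d \<inter> {..<Suc v}" "?g v = ?g (Suc v)"
      by (auto simp: fun_eq_iff less_Suc_eq)
    then have "runs (Incr ''v'') s 3 (assign_inv D f r d (Suc v))"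
      using inv by (intro runs_Store) (simp_all add: assign_inv_def frame_def update_def)
    then show ?thesis
      unfolding assign_body_def using test False by (intro runs_Cond) simp_all
  qed
qed

text \<open>The budget is 2 for the initial assignments, \<open>4 * n + 1\<close> for the loop and 5
  for the conditional.\<close>

lemma runs_select_body:
  assumes inv: "select_inv D f r i s" and "i < length Ss" "Ss ! i \<subseteq> {..<n}"
  shows "runs select_body s (4 * n + 8) (select_inv D f r (Suc i))"
proof -
  let ?I = "count_inv D f r i (s ''b'' 0) (s ''d'' 0) (s ''e'' 0)"
  let ?loop = "While (Minus (Var ''n'') (Var ''v'')) count_body"
  let ?test = "Cond (Minus (Var ''c'') (Var ''b''))
      (Seq (Assign ''b'' (Var ''c''))
      (Seq (Assign ''d'' (Var ''i''))
      (Seq (Assign ''e'' (Minus (Var ''o'') (Var ''n'')))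
      (Incr ''i''))))
      (Incr ''i'')"
  have loop: "runs ?loop s' (n * (3 + 1) + 1) (?I n)" if "?I 0 s'" for s'
    using that
    by (rule runs_While[where I = ?I])
      (simp add: count_inv_def frame_def, erule runs_count_body[OF _ assms(2)])
  have test: "runs ?test s' 5 (select_inv D f r (Suc i))" if "?I n s'" for s'
  proof -
    \<comment> \<open>The counter has thus reached the number of all uncovered elements of the
      candidate.\<close>
    have count: "(Ss ! i - D) \<inter> {..<n} = Ss ! i - D"
      using assms(3) by auto
    show ?thesis
    proof (cases "s' ''c'' 0 > s' ''b'' 0")
      case True
      have "runs (Seq (Assign ''b'' (Var ''c'')) (Seq (Assign ''d'' (Var ''i''))
          (Seq (Assign ''e'' (Minus (Var ''o'') (Var ''n''))) (Incr ''i'')))) s' 4 (select_inv D f r (Suc i))"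
        using inv that True assms(2)
        by (intro runs_Seq_Store runs_Store)
          (auto simp: select_inv_def count_inv_def frame_def update_def count less_Suc_eq)
      then show ?thesis
        using True by (intro runs_Cond) simp_all
    next
      case False
      then have "runs (Incr ''i'') s' 4 (select_inv D f r (Suc i))"
        using inv that
        by (intro runs_Store)
          (auto simp: select_inv_def count_inv_def frame_def update_def count less_Suc_eq)
      then show ?thesis
        using False by (intro runs_Cond) simp_all
    qed
  qed
  have both: "runs (Seq ?loop ?test) s' (n * (3 + 1) + 1 + 5) (select_inv D f r (Suc i))"
    if "?I 0 s'" for s'
    by (rule runs_Seq, rule runs_mono[OF loop[OF that]]) (rule order_refl, erule test)
  show ?thesis
    unfolding select_body_def
    by (rule runs_Seq_Store, simp, rule runs_Seq_Store, simp, rule runs_mono[OF both])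
      (use inv in \<open>simp_all add: select_inv_def count_inv_def frame_def update_def\<close>)
qed

section \<open>One greedy round\<close>

text \<open>The combinatorial content of a round, free of machine states: \<open>E\<close> and
  \<open>g\<close> are the covered set and the assignment afterwards.\<close>

lemma greedy_round:
  assumes "set_cover_instance {..<n} (set Ss)" "D \<subseteq> {..<n}" "d < length Ss"
    and best: "\<forall>j<length Ss. card (Ss ! j - D) \<le> card (Ss ! d - D)"
    and "card ({..<n} - D) \<le> n - r" "r < n" "\<forall>v\<in>D. f v < length Ss"
    and greedy: "\<forall>\<psi>. greedy_run (set Ss) ({..<n} - D) \<psi> \<longrightarrow> (\<forall>v\<in>D. \<psi> v = Ss ! f v) \<longrightarrow>
      greedy_run (set Ss) {..<n} \<psi>"
    and E: "E = D \<union> Ss ! d"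
    and g: "\<And>u. u < n \<Longrightarrow> g u = (if u \<in> Ss ! d - D then d else f u)"
  shows "E \<subseteq> {..<n}" "card ({..<n} - E) \<le> n - Suc r" "\<forall>v\<in>E. g v < length Ss"
    and "\<forall>\<psi>. greedy_run (set Ss) ({..<n} - E) \<psi> \<longrightarrow> (\<forall>v\<in>E. \<psi> v = Ss ! g v) \<longrightarrow>
      greedy_run (set Ss) {..<n} \<psi>"
proof -
  let ?U = "{..<n} - D"
  have union: "\<Union>(set Ss) = {..<n}"
    using assms(1) by (simp add: set_cover_instance_def)
  have sub: "S \<subseteq> {..<n}" if "S \<in> set Ss" for S
    using that union by blast
  have Int: "S \<inter> ?U = S - D" if "S \<in> set Ss" for S
    using sub[OF that] by blast
  have d: "Ss ! d \<in> set Ss"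
    using \<open>d < length Ss\<close> by simp
  show "E \<subseteq> {..<n}"
    using sub[OF d] \<open>D \<subseteq> {..<n}\<close> E by blast
  show "\<forall>v\<in>E. g v < length Ss"
    using \<open>E \<subseteq> {..<n}\<close> E g \<open>d < length Ss\<close> assms(7) by auto
  have U_E: "{..<n} - E = ?U - Ss ! d"
    unfolding E by blast
  have max: "\<forall>T\<in>set Ss. card (T \<inter> ?U) \<le> card (Ss ! d \<inter> ?U)"
    using best by (auto simp: Int[OF d] Int in_set_conv_nth)
  \<comment> \<open>If an element is left, some set of the collection contains it, so the best set
    covers at least one new element.\<close>
  show "card ({..<n} - E) \<le> n - Suc r"
  proof (cases "?U = {}")
    case True
    then show ?thesis
      unfolding U_E True by simp
  next
    case False
    then obtain v where v: "v \<in> ?U"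
      by blast
    then obtain T where "T \<in> set Ss" "v \<in> T"
      using union by blast
    with v have "0 < card (T \<inter> ?U)"
      by (auto simp: card_gt_0_iff)
    also have "\<dots> \<le> card (Ss ! d \<inter> ?U)"
      using max \<open>T \<in> set Ss\<close> by blast
    finally have "Ss ! d \<inter> ?U \<noteq> {}"
      by fastforce
    then have "?U - Ss ! d \<subset> ?U"
      by blast
    then have "card (?U - Ss ! d) < card ?U"
      by (intro psubset_card_mono) auto
    with assms(5) \<open>r < n\<close> show ?thesis
      by (simp add: U_E)
  qed
  show "\<forall>\<psi>. greedy_run (set Ss) ({..<n} - E) \<psi> \<longrightarrow> (\<forall>v\<in>E. \<psi> v = Ss ! g v) \<longrightarrow>
      greedy_run (set Ss) {..<n} \<psi>"
  proof (intro allI impI)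
    fix \<psi> assume \<psi>: "greedy_run (set Ss) ({..<n} - E) \<psi>" "\<forall>v\<in>E. \<psi> v = Ss ! g v"
    have assigned: "\<forall>v\<in>Ss ! d \<inter> ?U. \<psi> v = Ss ! d"
      using \<psi>(2) by (simp add: g E)
    \<comment> \<open>A run from the remaining elements is prolonged backwards by the choice of
      \<open>Ss ! d\<close>; an idle round needs \<open>stop\<close>, as \<open>pick\<close> demands
      uncovered elements.\<close>
    have "greedy_run (set Ss) ?U \<psi>"
    proof (cases "?U = {}")
      case True
      show ?thesis
        unfolding True by (rule greedy_run.stop)
    next
      case False
      show ?thesis
        by (rule greedy_run.pick[OF False d max assigned \<psi>(1)[unfolded U_E]])
    qed
    moreover have "\<forall>v\<in>D. \<psi> v = Ss ! f v"
      using \<psi>(2) \<open>D \<subseteq> {..<n}\<close> by (auto simp: g E)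
    ultimately show "greedy_run (set Ss) {..<n} \<psi>"
      using greedy by simp
  qed
qed

text \<open>The constant 9 collects five initialisations, two failing loop tests, the reset of
  \<open>v\<close> and the increment of \<open>r\<close>.\<close>

lemma runs_round_body:
  assumes inst: "set_cover_instance {..<n} (set Ss)" and inv: "round_inv r s" and "r < n"
  shows "runs round_body s (length Ss * (4 * n + 9) + 5 * n + 9) (round_inv (Suc r))"
proof -
  obtain D f where fr: "frame D f r s" and D: "D \<subseteq> {..<n}" "card ({..<n} - D) \<le> n - r"
    "\<forall>v\<in>D. f v < length Ss" "\<forall>\<psi>. greedy_run (set Ss) ({..<n} - D) \<psi> \<longrightarrow>
      (\<forall>v\<in>D. \<psi> v = Ss ! f v) \<longrightarrow> greedy_run (set Ss) {..<n} \<psi>"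
    using inv unfolding round_inv_def by blast
  have union: "\<Union>(set Ss) = {..<n}"
    using inst by (simp add: set_cover_instance_def)
  then have sub: "Ss ! i \<subseteq> {..<n}" if "i < length Ss" for i
    using nth_mem[OF that] by blast
  \<comment> \<open>This makes position 0, the default of \<open>d\<close>, a valid one.\<close>
  have "Ss \<noteq> []"
    using union \<open>r < n\<close> by auto
  let ?select = "While (Minus (Var ''k'') (Var ''i'')) select_body"
  let ?assign = "While (Minus (Var ''n'') (Var ''v'')) assign_body"
  have select: "runs ?select s' (length Ss * (4 * n + 8 + 1) + 1) (select_inv D f r (length Ss))"
    if "select_inv D f r 0 s'" for s'
    using that
    by (rule runs_While[where I = "select_inv D f r"])
      (simp add: select_inv_def frame_def, erule (1) runs_select_body, erule sub)
  have assign: "runs ?assign s' (n * (4 + 1) + 1) (assign_inv D f r d n)"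
    if "assign_inv D f r d 0 s'" "d < length Ss" for s' d
    using that(1)
    by (rule runs_While[where I = "assign_inv D f r d"])
      (simp add: assign_inv_def frame_def, erule runs_assign_body[OF _ that(2)])
  have incr: "runs (Incr ''r'') s' 1 (round_inv (Suc r))"
    if "assign_inv D f r d n s'" and d: "d < length Ss"
      and best: "\<forall>j<length Ss. card (Ss ! j - D) \<le> card (Ss ! d - D)" for s' d
  proof (rule runs_Store)
    let ?E = "D \<union> Ss ! d" and ?g = "\<lambda>u. if u < n \<and> u \<in> Ss ! d - D then d else f u"
    have "Ss ! d \<inter> {..<n} = Ss ! d"
      using sub[OF d] by blast
    then have "frame ?E ?g (Suc r) (update s' ''r'' (eval_expr (Const 0) s')
        (eval_expr (Plus (Var ''r'') (Const 1)) s'))"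
      using that(1) by (simp add: assign_inv_def frame_def update_def)
    then show "round_inv (Suc r) (update s' ''r'' (eval_expr (Const 0) s')
        (eval_expr (Plus (Var ''r'') (Const 1)) s'))"
      unfolding round_inv_def
      by (intro exI[of _ ?E] exI[of _ ?g] conjI
          greedy_round[OF inst D(1) d best D(2) \<open>r < n\<close> D(3,4) refl, of ?g]) simp_all
  qed simp
  have second: "runs (Seq (Assign ''v'' (Const 0)) (Seq ?assign (Incr ''r''))) s' (n * (4 + 1) + 1 + 1 + 1)
      (round_inv (Suc r))" if "select_inv D f r (length Ss) s'" for s'
  proof (rule runs_Seq_Store)
    let ?d = "s' ''d'' 0"
    have d: "?d < length Ss" "\<forall>j<length Ss. card (Ss ! j - D) \<le> card (Ss ! ?d - D)"
      using that by (auto simp: select_inv_def)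
    have "assign_inv D f r ?d 0 (update s' ''v'' (eval_expr (Const 0) s') (eval_expr (Const 0) s'))"
      using that by (simp add: select_inv_def assign_inv_def frame_def update_def)
    then have "runs (Seq ?assign (Incr ''r'')) (update s' ''v'' (eval_expr (Const 0) s')
        (eval_expr (Const 0) s')) (n * (4 + 1) + 1 + 1) (round_inv (Suc r))"
      by (intro runs_Seq runs_mono[OF assign[OF _ d(1)]] order_refl) (assumption, erule incr[OF _ d])
    then show "runs (Seq ?assign (Incr ''r'')) (update s' ''v'' (eval_expr (Const 0) s')
        (eval_expr (Const 0) s')) (n * (4 + 1) + 1 + 1 + 1 - 1) (round_inv (Suc r))"
      by simp
  qed simp
  have both: "runs (Seq ?select (Seq (Assign ''v'' (Const 0)) (Seq ?assign (Incr ''r'')))) s'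
      (length Ss * (4 * n + 8 + 1) + 1 + (n * (4 + 1) + 1 + 1 + 1)) (round_inv (Suc r))"
    if "select_inv D f r 0 s'" for s'
    by (rule runs_Seq, rule runs_mono[OF select[OF that]]) (rule order_refl, erule second)
  show ?thesis
    unfolding round_body_def
    by (rule runs_Seq_Store, simp, rule runs_Seq_Store, simp, rule runs_Seq_Store, simp,
        rule runs_Seq_Store, simp, rule runs_Seq_Store, simp, rule runs_mono[OF both])
      (use fr \<open>Ss \<noteq> []\<close> in \<open>simp_all add: select_inv_def frame_def update_def\<close>)
qed

section \<open>The whole program and its polynomial bound\<close>

lemma runs_greedy_prog:
  assumes inst: "set_cover_instance {..<n} (set Ss)"
  shows "runs greedy_prog (encode n Ss) (n * (length Ss * (4 * n + 9) + 5 * n + 9 + 1) + 1)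
    (\<lambda>s. (\<forall>v<n. s ''out'' v < length Ss) \<and> greedy_run (set Ss) {..<n} (decode Ss s))"
proof -
  have "frame {} (\<lambda>_. 0) 0 (encode n Ss)"
    by (auto simp: frame_def encode_def)
  then have init: "round_inv 0 (encode n Ss)"
    unfolding round_inv_def by (intro exI[of _ "{}"] exI[of _ "\<lambda>_. 0"]) simp
  have guard: "s ''n'' 0 = n \<and> s ''r'' 0 = r" if "round_inv r s" for r s
    using that unfolding round_inv_def frame_def by (elim exE conjE) (rule conjI)
  from init have "runs greedy_prog (encode n Ss) (n * (length Ss * (4 * n + 9) + 5 * n + 9 + 1) + 1)
      (round_inv n)"
    unfolding greedy_prog_def
    by (rule runs_While[where I = round_inv])
      (simp add: guard, erule runs_round_body[OF inst])
  then show ?thesis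
  proof (rule runs_mono[OF _ order_refl])
    fix s assume "round_inv n s"
    then obtain D f where fr: "frame D f n s" and "D \<subseteq> {..<n}" "card ({..<n} - D) \<le> n - n"
      and f: "\<forall>v\<in>D. f v < length Ss" and greedy: "\<forall>\<psi>. greedy_run (set Ss) ({..<n} - D) \<psi> \<longrightarrow>
        (\<forall>v\<in>D. \<psi> v = Ss ! f v) \<longrightarrow> greedy_run (set Ss) {..<n} \<psi>"
      unfolding round_inv_def by (elim exE conjE)
    then have "{..<n} - D = {}"
      by (metis card_0_eq diff_self_eq_0 finite_Diff finite_lessThan le_zero_eq)
    with \<open>D \<subseteq> {..<n}\<close> have D: "D = {..<n}"
      by blast
    have out: "s ''out'' = f"
      using fr by (simp add: frame_def)
    \<comment> \<open>The decoded output serves as \<open>\<psi>\<close> in the invariant; no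
      elements remain, so the rest of its run is empty.\<close>
    have "greedy_run (set Ss) ({..<n} - D) (decode Ss s)"
      unfolding \<open>{..<n} - D = {}\<close> by (rule greedy_run.stop)
    then have "greedy_run (set Ss) {..<n} (decode Ss s)"
      using greedy by (simp add: decode_def out)
    then show "(\<forall>v<n. s ''out'' v < length Ss) \<and> greedy_run (set Ss) {..<n} (decode Ss s)"
      using f by (simp add: out D)
  qed
qed

end

lemma poly_time_greedy: "poly_time_algorithm greedy_prog greedy_output"
  unfolding poly_time_algorithm_def
proof (rule exI, intro allI impI)
  fix n and Ss :: "nat set list"
  assume inst: "set_cover_instance {..<n} (set Ss)"
  let ?N = "input_size n Ss"
  \<comment> \<open>The factor 10 dominates every coefficient on the left.\<close>
  have "length Ss * (4 * n + 9) + 5 * n + 9 + 1 \<le> 10 * (1 + ?N)"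
    by (simp add: input_size_def algebra_simps)
  moreover have "n \<le> ?N"
    by (simp add: input_size_def)
  ultimately have "n * (length Ss * (4 * n + 9) + 5 * n + 9 + 1) \<le> ?N * (10 * (1 + ?N))"
    by (intro mult_le_mono)
  then have "n * (length Ss * (4 * n + 9) + 5 * n + 9 + 1) + 1 \<le> poly [:1, 10, 10:] ?N"
    by (simp add: algebra_simps)
  with runs_greedy_prog[OF inst]
  show "\<exists>t s. exec greedy_prog (encode n Ss) t s \<and> t \<le> poly [:1, 10, 10:] ?N \<and>
      (\<forall>v<n. s ''out'' v < length Ss) \<and> greedy_output {..<n} (set Ss) (decode Ss s)"
    unfolding runs_def greedy_output_def by (blast intro: le_trans)
qed

text \<open>The program produces one particular greedy run, whereas the ratio holds for every way of
  breaking ties.\<close>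

theorem theorem2:
  fixes p q :: real
  assumes "q > 1" and "p = - q"
  shows "(\<exists>c. poly_time_algorithm c greedy_output) \<and>
    (\<forall>(V :: 'a set) \<S> \<phi>. set_cover_instance V \<S> \<and> greedy_output V \<S> \<phi> \<longrightarrow>
       is_cover V \<S> \<phi> \<and>
       cover_value p V \<phi> \<ge>
         OPT p V \<S> / (real (card V) powr (1 - 1 / q) * zeta_real q powr (1 / q)))"
  using poly_time_greedy greedy_run_is_cover greedy_cover_value_ge[OF assms(1)] assms(2)
  by (simp add: greedy_output_def) blast

end
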